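(* Let $\mathcal{B}$ be a block schema and $G$ a context expression such that $\mathcal{B}\leadsto_b G$ is derivable. Then $\pi.\mathcal{B}\leadsto_b G$ is derivable for any variable permutation $\pi$ (for which $\pi.\mathcal{B}$ is defined).
   Context: Canonical LF over a fixed well-formed signature $\Sigma$: types $A ::= P\mid\Pi x{:}A.B$, $P ::= a\mid P\,M$, terms $M ::= R\mid\lambda x.M$, $R ::= c\mid x\mid R\,M$ (only $\beta$-normal forms). Arity types are simple types over one base type $o$ built with $\to$; erasure: $P^-=o$, $(\Pi x{:}A_1.A_2)^-=A_1^-\to A_2^-$; $\Sigma^-=\{c{:}A^-\mid c{:}A\in\Sigma\}$. Arity typing $\Theta\vdash M:\alpha$ checks canonical form and functional structure w.r.t. an arity context $\Theta$. A substitution is a finite set $\theta=\{\langle x_i,M_i,\alpha_i\rangle\}$; $E[\theta]$ is its hereditary application (capture-avoiding replacement followed by normalization guided by arity types), possibly undefined. $\mathcal{N}$ is a set of nominal constants, each with an arity type (infinitely many per arity type), behaving like constants in terms and types. Context expressions (variable-free case) are $G ::= \cdot\mid G,n{:}A$ with $n$ a nominal constant; substitutions act on them through the types of bindings. Block schemas and instances. Block declarations $\Delta ::= \cdot\mid\Delta,y{:}A$; block schemas $\mathcal{B}=\{x_1{:}\alpha_1,\ldots,x_n{:}\alpha_n\}\Delta$. $\cdot\leadsto(\cdot;\emptyset)$; if $\Delta\leadsto(G;\theta)$ and $n\in\mathcal{N}$ has arity type $A^-$, then $\Delta,y{:}A\leadsto(G,n{:}A[\theta];\ \theta\cup\{\langle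 y,n,A^-\rangle\})$. $\{x_1{:}\alpha_1,\ldots,x_n{:}\alpha_n\}\Delta\leadsto_b G'[\{\langle x_i,t_i,\alpha_i\rangle\mid1\le i\le n\}]$ whenever $\Delta\leadsto(G';\theta)$ and $\mathcal{N}\cup\Sigma^-\vdash t_i:\alpha_i$ for all $i$. Variants. A variable permutation $\pi$ is a bijection on variables that is the identity except at finitely many points. For an arity context $\Theta$, $\pi_\Theta=\{\langle x,\pi.x,\alpha'\rangle\mid\pi.x\ne x\}$ with $\alpha'=\alpha$ if $x{:}\alpha\in\Theta$ and $o$ otherwise. For $\mathcal{B}=\{x_1{:}\alpha_1,\ldots,x_n{:}\alpha_n\}y_1{:}A_1,\ldots,y_m{:}A_m$, $\Theta_{\mathcal{B}}=\Sigma^-\cup\{x_1{:}\alpha_1,\ldots,x_n{:}\alpha_n,y_1{:}A_1^-,\ldots,y_m{:}A_m^-\}$ and $\pi.\mathcal{B}=\{\pi.x_1{:}\alpha_1,\ldots,\pi.x_n{:}\alpha_n\}\,\pi.y_1{:}A_1[\pi_{\Theta_{\mathcal{B}}}],\ldots,\pi.y_m{:}A_m[\pi_{\Theta_{\mathcal{B}}}]$, assuming these hereditary substitutions are defined (which holds when $\mathcal{B}$ is well-formed).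
   Formalization: Block schemas are assumed well scoped: distinct names, and each A_i has free variables only among the x's and earlier y's. Without scoping the claim fails: {} y:a u has instance n:a u, but if π swaps u and w its variant {} y:a w does not. *)

theory Defs
  imports Main
begin

section \<open>Expressions of canonical LF\<close>

type_synonym var = string
type_synonym const = string
type_synonym tconst = string

datatype arity = Base | Arr arity arity

text \<open>The arity is part of a nominal constant, so there are infinitely many of each arity.\<close>
datatype nominal = Nominal (nom_index: nat) (nom_arity: arity)

datatype head = Const const | Nom nominal | Free var

text \<open>
  Expressions are taken up to renaming of bound variables by means of a locally nameless
  representation: free variables are named, and an occurrence of a bound variable is a de Bruijn
  index. The rules below never inspect an index. They open a binder with a fresh name
  first, exactly as a rule over named syntax would, and consequently they apply only to expressions
  without dangling indices. The separation of \<^term>\<open>cterm\<close> and \<^term>\<open>aterm\<close> rules out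
  beta-redexes.
\<close>

datatype cterm = At aterm | Lam cterm
and aterm = Hd head | Bound nat | App aterm cterm

datatype atype = TConst tconst | TApp atype cterm
datatype ty = AtTy atype | Pi ty ty
datatype kind = Type | KPi ty kind

primrec open_cterm :: "nat \<Rightarrow> var \<Rightarrow> cterm \<Rightarrow> cterm"
  and open_aterm :: "nat \<Rightarrow> var \<Rightarrow> aterm \<Rightarrow> aterm" where
  "open_cterm k x (At R) = At (open_aterm k x R)"
| "open_cterm k x (Lam M) = Lam (open_cterm (Suc k) x M)"
| "open_aterm k x (Hd h) = Hd h"
| "open_aterm k x (Bound i) = (if i = k then Hd (Free x) else Bound i)"
| "open_aterm k x (App R M) = App (open_aterm k x R) (open_cterm k x M)"

primrec open_atype :: "nat \<Rightarrow> var \<Rightarrow> atype \<Rightarrow> atype" where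
  "open_atype k x (TConst a) = TConst a"
| "open_atype k x (TApp P M) = TApp (open_atype k x P) (open_cterm k x M)"

primrec open_ty :: "nat \<Rightarrow> var \<Rightarrow> ty \<Rightarrow> ty" where
  "open_ty k x (AtTy P) = AtTy (open_atype k x P)"
| "open_ty k x (Pi A B) = Pi (open_ty k x A) (open_ty (Suc k) x B)"

primrec open_kind :: "nat \<Rightarrow> var \<Rightarrow> kind \<Rightarrow> kind" where
  "open_kind k x Type = Type"
| "open_kind k x (KPi A K) = KPi (open_ty k x A) (open_kind (Suc k) x K)"

primrec fv_head :: "head \<Rightarrow> var set" where
  "fv_head (Const c) = {}"
| "fv_head (Nom n) = {}"
| "fv_head (Free x) = {x}"

primrec fv_cterm :: "cterm \<Rightarrow> var set" and fv_aterm :: "aterm \<Rightarrow> var set" where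
  "fv_cterm (At R) = fv_aterm R"
| "fv_cterm (Lam M) = fv_cterm M"
| "fv_aterm (Hd h) = fv_head h"
| "fv_aterm (Bound i) = {}"
| "fv_aterm (App R M) = fv_aterm R \<union> fv_cterm M"

primrec fv_atype :: "atype \<Rightarrow> var set" where
  "fv_atype (TConst a) = {}"
| "fv_atype (TApp P M) = fv_atype P \<union> fv_cterm M"

primrec fv_ty :: "ty \<Rightarrow> var set" where
  "fv_ty (AtTy P) = fv_atype P"
| "fv_ty (Pi A B) = fv_ty A \<union> fv_ty B"

primrec fv_kind :: "kind \<Rightarrow> var set" where
  "fv_kind Type = {}"
| "fv_kind (KPi A K) = fv_ty A \<union> fv_kind K"

primrec erase :: "ty \<Rightarrow> arity" where
  "erase (AtTy P) = Base"
| "erase (Pi A B) = Arr (erase A) (erase B)"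


section \<open>Arity typing\<close>

text \<open>An arity context assigns arities to constants, nominal constants and variables alike.\<close>
type_synonym arity_ctx = "head \<rightharpoonup> arity"

inductive arity_cterm :: "arity_ctx \<Rightarrow> cterm \<Rightarrow> arity \<Rightarrow> bool"
  and arity_aterm :: "arity_ctx \<Rightarrow> aterm \<Rightarrow> arity \<Rightarrow> bool" where
  arity_At: "arity_aterm \<Theta> R \<alpha> \<Longrightarrow> arity_cterm \<Theta> (At R) \<alpha>"
| arity_Lam: "\<lbrakk> x \<notin> fv_cterm M; Free x \<notin> dom \<Theta>;
    arity_cterm (\<Theta>(Free x \<mapsto> \<alpha>)) (open_cterm 0 x M) \<beta> \<rbrakk>
    \<Longrightarrow> arity_cterm \<Theta> (Lam M) (Arr \<alpha> \<beta>)"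
| arity_Hd: "\<Theta> h = Some \<alpha> \<Longrightarrow> arity_aterm \<Theta> (Hd h) \<alpha>"
| arity_App: "\<lbrakk> arity_aterm \<Theta> R (Arr \<alpha> \<beta>); arity_cterm \<Theta> M \<alpha> \<rbrakk>
    \<Longrightarrow> arity_aterm \<Theta> (App R M) \<beta>"


section \<open>Hereditary substitution\<close>

text \<open>A substitution is a set of triples with distinct variables, that is, a partial map.\<close>
type_synonym subst = "var \<rightharpoonup> cterm \<times> arity"

definition fv_subst :: "subst \<Rightarrow> var set" where
  "fv_subst \<theta> = dom \<theta> \<union> (\<Union>(M, \<alpha>) \<in> ran \<theta>. fv_cterm M)"

text \<open>
  Substituting into an atomic term gives either an atomic term, which can be applied to arguments
  as it stands, or the abstraction \<^term>\<open>Lam M\<close>, recorded as \<^term>\<open>LamRes M \<alpha>\<close> with the arity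
  that guides its further reduction.
\<close>
datatype hres = AtRes aterm | LamRes cterm arity

primrec hres_of :: "cterm \<Rightarrow> arity \<Rightarrow> hres" where
  "hres_of (At R) \<alpha> = AtRes R"
| "hres_of (Lam M) \<alpha> = LamRes M \<alpha>"

text \<open>
  The application is partial, hence a relation: \<^term>\<open>hsub_cterm \<theta> M M'\<close> says that the
  application of \<^term>\<open>\<theta>\<close> to \<^term>\<open>M\<close> is defined and is \<^term>\<open>M'\<close>.
\<close>
inductive hsub_cterm :: "subst \<Rightarrow> cterm \<Rightarrow> cterm \<Rightarrow> bool"
  and hsub_aterm :: "subst \<Rightarrow> aterm \<Rightarrow> hres \<Rightarrow> bool" where
  hsub_At: "hsub_aterm \<theta> R (AtRes R') \<Longrightarrow> hsub_cterm \<theta> (At R) (At R')"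
| hsub_At_Lam: "hsub_aterm \<theta> R (LamRes M \<alpha>) \<Longrightarrow> hsub_cterm \<theta> (At R) (Lam M)"
| hsub_Lam: "\<lbrakk> x \<notin> fv_cterm M \<union> fv_cterm M' \<union> fv_subst \<theta>;
    hsub_cterm \<theta> (open_cterm 0 x M) (open_cterm 0 x M') \<rbrakk>
    \<Longrightarrow> hsub_cterm \<theta> (Lam M) (Lam M')"
| hsub_Const: "hsub_aterm \<theta> (Hd (Const c)) (AtRes (Hd (Const c)))"
| hsub_Nom: "hsub_aterm \<theta> (Hd (Nom n)) (AtRes (Hd (Nom n)))"
| hsub_Free_None: "\<theta> x = None \<Longrightarrow> hsub_aterm \<theta> (Hd (Free x)) (AtRes (Hd (Free x)))"
| hsub_Free_Some: "\<theta> x = Some (M, \<alpha>) \<Longrightarrow> hsub_aterm \<theta> (Hd (Free x)) (hres_of M \<alpha>)"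
| hsub_App: "\<lbrakk> hsub_aterm \<theta> R (AtRes R'); hsub_cterm \<theta> M M' \<rbrakk>
    \<Longrightarrow> hsub_aterm \<theta> (App R M) (AtRes (App R' M'))"
| hsub_Beta: "\<lbrakk> hsub_aterm \<theta> R (LamRes N (Arr \<alpha> \<beta>)); hsub_cterm \<theta> M M';
    x \<notin> fv_cterm N; hsub_cterm [x \<mapsto> (M', \<alpha>)] (open_cterm 0 x N) N' \<rbrakk>
    \<Longrightarrow> hsub_aterm \<theta> (App R M) (hres_of N' \<beta>)"

inductive hsub_atype :: "subst \<Rightarrow> atype \<Rightarrow> atype \<Rightarrow> bool" where
  hsub_TConst: "hsub_atype \<theta> (TConst a) (TConst a)"
| hsub_TApp: "\<lbrakk> hsub_atype \<theta> P P'; hsub_cterm \<theta> M M' \<rbrakk>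
    \<Longrightarrow> hsub_atype \<theta> (TApp P M) (TApp P' M')"

inductive hsub_ty :: "subst \<Rightarrow> ty \<Rightarrow> ty \<Rightarrow> bool" where
  hsub_AtTy: "hsub_atype \<theta> P P' \<Longrightarrow> hsub_ty \<theta> (AtTy P) (AtTy P')"
| hsub_Pi: "\<lbrakk> hsub_ty \<theta> A A'; x \<notin> fv_ty B \<union> fv_ty B' \<union> fv_subst \<theta>;
    hsub_ty \<theta> (open_ty 0 x B) (open_ty 0 x B') \<rbrakk>
    \<Longrightarrow> hsub_ty \<theta> (Pi A B) (Pi A' B')"

inductive hsub_kind :: "subst \<Rightarrow> kind \<Rightarrow> kind \<Rightarrow> bool" where
  hsub_Type: "hsub_kind \<theta> Type Type"
| hsub_KPi: "\<lbrakk> hsub_ty \<theta> A A'; x \<notin> fv_kind K \<union> fv_kind K' \<union> fv_subst \<theta>;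
    hsub_kind \<theta> (open_kind 0 x K) (open_kind 0 x K') \<rbrakk>
    \<Longrightarrow> hsub_kind \<theta> (KPi A K) (KPi A' K')"


section \<open>Signatures\<close>

datatype decl = ConDecl const ty | FamDecl tconst kind

text \<open>Signatures list their declarations in reverse order, the most recent one first.\<close>
type_synonym sig = "decl list"

definition con_type :: "sig \<Rightarrow> const \<rightharpoonup> ty" where
  "con_type \<Sigma> = map_of (concat (map (\<lambda>d. case d of ConDecl c A \<Rightarrow> [(c, A)] | _ \<Rightarrow> []) \<Sigma>))"

definition fam_kind :: "sig \<Rightarrow> tconst \<rightharpoonup> kind" where
  "fam_kind \<Sigma> = map_of (concat (map (\<lambda>d. case d of FamDecl a K \<Rightarrow> [(a, K)] | _ \<Rightarrow> []) \<Sigma>))"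

type_synonym lf_ctx = "var \<rightharpoonup> ty"

text \<open>
  The LF typing rules: \<^term>\<open>lf_check \<Sigma> \<Gamma> M A\<close> checks a canonical term against a type, and
  \<^term>\<open>lf_synth \<Sigma> \<Gamma> R A\<close> synthesizes the type of an atomic term. Nominal constants are not typable.
\<close>
inductive lf_check :: "sig \<Rightarrow> lf_ctx \<Rightarrow> cterm \<Rightarrow> ty \<Rightarrow> bool"
  and lf_synth :: "sig \<Rightarrow> lf_ctx \<Rightarrow> aterm \<Rightarrow> ty \<Rightarrow> bool" for \<Sigma> where
  check_At: "lf_synth \<Sigma> \<Gamma> R (AtTy P) \<Longrightarrow> lf_check \<Sigma> \<Gamma> (At R) (AtTy P)"
| check_Lam: "\<lbrakk> x \<notin> fv_cterm M \<union> fv_ty B \<union> dom \<Gamma>;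
    lf_check \<Sigma> (\<Gamma>(x \<mapsto> A)) (open_cterm 0 x M) (open_ty 0 x B) \<rbrakk>
    \<Longrightarrow> lf_check \<Sigma> \<Gamma> (Lam M) (Pi A B)"
| synth_Const: "con_type \<Sigma> c = Some A \<Longrightarrow> lf_synth \<Sigma> \<Gamma> (Hd (Const c)) A"
| synth_Free: "\<Gamma> x = Some A \<Longrightarrow> lf_synth \<Sigma> \<Gamma> (Hd (Free x)) A"
| synth_App: "\<lbrakk> lf_synth \<Sigma> \<Gamma> R (Pi A B); lf_check \<Sigma> \<Gamma> M A; x \<notin> fv_ty B;
    hsub_ty [x \<mapsto> (M, erase A)] (open_ty 0 x B) C \<rbrakk>
    \<Longrightarrow> lf_synth \<Sigma> \<Gamma> (App R M) C"

inductive lf_atype :: "sig \<Rightarrow> lf_ctx \<Rightarrow> atype \<Rightarrow> kind \<Rightarrow> bool" for \<Sigma> where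
  lf_TConst: "fam_kind \<Sigma> a = Some K \<Longrightarrow> lf_atype \<Sigma> \<Gamma> (TConst a) K"
| lf_TApp: "\<lbrakk> lf_atype \<Sigma> \<Gamma> P (KPi A K); lf_check \<Sigma> \<Gamma> M A; x \<notin> fv_kind K;
    hsub_kind [x \<mapsto> (M, erase A)] (open_kind 0 x K) K' \<rbrakk>
    \<Longrightarrow> lf_atype \<Sigma> \<Gamma> (TApp P M) K'"

inductive lf_ty :: "sig \<Rightarrow> lf_ctx \<Rightarrow> ty \<Rightarrow> bool" for \<Sigma> where
  lf_AtTy: "lf_atype \<Sigma> \<Gamma> P Type \<Longrightarrow> lf_ty \<Sigma> \<Gamma> (AtTy P)"
| lf_Pi: "\<lbrakk> lf_ty \<Sigma> \<Gamma> A; x \<notin> fv_ty B \<union> dom \<Gamma>; lf_ty \<Sigma> (\<Gamma>(x \<mapsto> A)) (open_ty 0 x B) \<rbrakk>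
    \<Longrightarrow> lf_ty \<Sigma> \<Gamma> (Pi A B)"

inductive lf_kind :: "sig \<Rightarrow> lf_ctx \<Rightarrow> kind \<Rightarrow> bool" for \<Sigma> where
  lf_Type: "lf_kind \<Sigma> \<Gamma> Type"
| lf_KPi: "\<lbrakk> lf_ty \<Sigma> \<Gamma> A; x \<notin> fv_kind K \<union> dom \<Gamma>; lf_kind \<Sigma> (\<Gamma>(x \<mapsto> A)) (open_kind 0 x K) \<rbrakk>
    \<Longrightarrow> lf_kind \<Sigma> \<Gamma> (KPi A K)"

inductive wf_sig :: "sig \<Rightarrow> bool" where
  wf_sig_Nil: "wf_sig []"
| wf_sig_Con: "\<lbrakk> wf_sig \<Sigma>; c \<notin> dom (con_type \<Sigma>); lf_ty \<Sigma> Map.empty A \<rbrakk>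
    \<Longrightarrow> wf_sig (ConDecl c A # \<Sigma>)"
| wf_sig_Fam: "\<lbrakk> wf_sig \<Sigma>; a \<notin> dom (fam_kind \<Sigma>); lf_kind \<Sigma> Map.empty K \<rbrakk>
    \<Longrightarrow> wf_sig (FamDecl a K # \<Sigma>)"

definition sig_arities :: "sig \<Rightarrow> arity_ctx" where
  "sig_arities \<Sigma> = (\<lambda>h. case h of Const c \<Rightarrow> map_option erase (con_type \<Sigma> c) | _ \<Rightarrow> None)"

definition nom_arities :: arity_ctx where
  "nom_arities = (\<lambda>h. case h of Nom n \<Rightarrow> Some (nom_arity n) | _ \<Rightarrow> None)"


section \<open>Block schemas and their instances\<close>

text \<open>Context expressions and block declarations list their entries from left to right.\<close>
type_synonym ctx_expr = "(nominal \<times> ty) list"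
type_synonym block_decls = "(var \<times> ty) list"

datatype schema = Schema "(var \<times> arity) list" block_decls

text \<open>
  A schema binds its parameters in all declarations and each declared variable in the
  declarations after it; distinct binders carry distinct names and there are no other free
  variables. Arities and kinds are not constrained. A stray variable would occur in the instances
  of the schema without being replaced, but would be renamed in a variant of the schema.
\<close>
fun block_schema :: "schema \<Rightarrow> bool" where
  "block_schema (Schema X \<Delta>) \<longleftrightarrow>
     distinct (map fst X @ map fst \<Delta>) \<and>
     (\<forall>i < length \<Delta>. fv_ty (snd (\<Delta> ! i)) \<subseteq> fst ` set X \<union> fst ` set (take i \<Delta>))"

inductive decls_inst :: "block_decls \<Rightarrow> ctx_expr \<Rightarrow> subst \<Rightarrow> bool" where
  decls_inst_Nil: "decls_inst [] [] Map.empty"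
| decls_inst_snoc: "\<lbrakk> decls_inst \<Delta> G \<theta>; nom_arity n = erase A; hsub_ty \<theta> A A' \<rbrakk>
    \<Longrightarrow> decls_inst (\<Delta> @ [(y, A)]) (G @ [(n, A')]) (\<theta>(y \<mapsto> (At (Hd (Nom n)), erase A)))"

definition hsub_ctx :: "subst \<Rightarrow> ctx_expr \<Rightarrow> ctx_expr \<Rightarrow> bool" where
  "hsub_ctx \<theta> = list_all2 (\<lambda>(n, A) (n', A'). n = n' \<and> hsub_ty \<theta> A A')"

inductive block_inst :: "sig \<Rightarrow> schema \<Rightarrow> ctx_expr \<Rightarrow> bool" for \<Sigma> where
  "\<lbrakk> decls_inst \<Delta> G' \<theta>;
     list_all2 (\<lambda>(x, \<alpha>) t. arity_cterm (nom_arities ++ sig_arities \<Sigma>) t \<alpha>) X ts;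
     hsub_ctx (map_of (map2 (\<lambda>(x, \<alpha>) t. (x, (t, \<alpha>))) X ts)) G' G \<rbrakk>
    \<Longrightarrow> block_inst \<Sigma> (Schema X \<Delta>) G"


section \<open>Variants\<close>

definition var_perm :: "(var \<Rightarrow> var) \<Rightarrow> bool" where
  "var_perm \<pi> \<longleftrightarrow> bij \<pi> \<and> finite {x. \<pi> x \<noteq> x}"

definition perm_subst :: "arity_ctx \<Rightarrow> (var \<Rightarrow> var) \<Rightarrow> subst" where
  "perm_subst \<Theta> \<pi> = (\<lambda>x. if \<pi> x \<noteq> x
     then Some (At (Hd (Free (\<pi> x))), case \<Theta> (Free x) of Some \<alpha> \<Rightarrow> \<alpha> | None \<Rightarrow> Base)
     else None)"

fun schema_arities :: "sig \<Rightarrow> schema \<Rightarrow> arity_ctx" where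
  "schema_arities \<Sigma> (Schema X \<Delta>) = sig_arities \<Sigma> ++
     map_of (map (\<lambda>(x, \<alpha>). (Free x, \<alpha>)) X @ map (\<lambda>(y, A). (Free y, erase A)) \<Delta>)"

text \<open>\<^term>\<open>variant \<Sigma> \<pi> \<B> \<B>'\<close> says that the variant of \<^term>\<open>\<B>\<close> under \<^term>\<open>\<pi>\<close> is defined and is \<^term>\<open>\<B>'\<close>.\<close>
inductive variant :: "sig \<Rightarrow> (var \<Rightarrow> var) \<Rightarrow> schema \<Rightarrow> schema \<Rightarrow> bool" for \<Sigma> \<pi> where
  "list_all2 (\<lambda>(y, A) (y', A'). y' = \<pi> y \<and>
       hsub_ty (perm_subst (schema_arities \<Sigma> (Schema X \<Delta>)) \<pi>) A A') \<Delta> \<Delta>'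
    \<Longrightarrow> variant \<Sigma> \<pi> (Schema X \<Delta>) (Schema (map (\<lambda>(x, \<alpha>). (\<pi> x, \<alpha>)) X) \<Delta>')"

end

theory Submission
  imports Defs
begin

text \<open>
  Hereditary substitution is equivariant under bijective renamings of variables, and applying
  \<open>\<pi>\<^sub>\<Theta>\<close> is just such a renaming: it puts atomic terms in place of variables, so no reduction is
  ever triggered. Renaming by \<open>\<pi>\<close> therefore turns a derivation for a schema into one for its variant
  whose result is the renamed context expression. That expression is the original one, because
  an instance of a schema has no free variables.
\<close>

section \<open>Renaming of free variables\<close>

primrec ren_head :: "(var \<Rightarrow> var) \<Rightarrow> head \<Rightarrow> head" where
  "ren_head \<pi> (Const c) = Const c"
| "ren_head \<pi> (Nom n) = Nom n"
| "ren_head \<pi> (Free x) = Free (\<pi> x)"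

primrec ren_cterm :: "(var \<Rightarrow> var) \<Rightarrow> cterm \<Rightarrow> cterm"
  and ren_aterm :: "(var \<Rightarrow> var) \<Rightarrow> aterm \<Rightarrow> aterm" where
  "ren_cterm \<pi> (At R) = At (ren_aterm \<pi> R)"
| "ren_cterm \<pi> (Lam M) = Lam (ren_cterm \<pi> M)"
| "ren_aterm \<pi> (Hd h) = Hd (ren_head \<pi> h)"
| "ren_aterm \<pi> (Bound i) = Bound i"
| "ren_aterm \<pi> (App R M) = App (ren_aterm \<pi> R) (ren_cterm \<pi> M)"

primrec ren_atype :: "(var \<Rightarrow> var) \<Rightarrow> atype \<Rightarrow> atype" where
  "ren_atype \<pi> (TConst a) = TConst a"
| "ren_atype \<pi> (TApp P M) = TApp (ren_atype \<pi> P) (ren_cterm \<pi> M)"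

primrec ren_ty :: "(var \<Rightarrow> var) \<Rightarrow> ty \<Rightarrow> ty" where
  "ren_ty \<pi> (AtTy P) = AtTy (ren_atype \<pi> P)"
| "ren_ty \<pi> (Pi A B) = Pi (ren_ty \<pi> A) (ren_ty \<pi> B)"

primrec ren_hres :: "(var \<Rightarrow> var) \<Rightarrow> hres \<Rightarrow> hres" where
  "ren_hres \<pi> (AtRes R) = AtRes (ren_aterm \<pi> R)"
| "ren_hres \<pi> (LamRes M \<alpha>) = LamRes (ren_cterm \<pi> M) \<alpha>"

text \<open>This is the conjugate of \<open>\<theta>\<close> by \<open>\<pi>\<close>: keys and
  substituted terms are both renamed, arities are kept. A map is indexed by the new key, hence the
  inverse on the argument.\<close>

definition ren_subst :: "(var \<Rightarrow> var) \<Rightarrow> subst \<Rightarrow> subst" where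
  "ren_subst \<pi> \<theta> = (\<lambda>x. map_option (map_prod (ren_cterm \<pi>) id) (\<theta> (inv \<pi> x)))"

lemma ren_open_term:
  "ren_cterm \<pi> (open_cterm k x M) = open_cterm k (\<pi> x) (ren_cterm \<pi> M)"
  "ren_aterm \<pi> (open_aterm k x R) = open_aterm k (\<pi> x) (ren_aterm \<pi> R)"
  by (induction M and R arbitrary: k and k rule: cterm.induct aterm.induct) auto

lemma ren_open_atype: "ren_atype \<pi> (open_atype k x P) = open_atype k (\<pi> x) (ren_atype \<pi> P)"
  by (induction P) (auto simp: ren_open_term)

lemma ren_open_ty: "ren_ty \<pi> (open_ty k x A) = open_ty k (\<pi> x) (ren_ty \<pi> A)"
  by (induction A arbitrary: k) (auto simp: ren_open_atype)

lemma fv_ren_head: "fv_head (ren_head \<pi> h) = \<pi> ` fv_head h"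
  by (cases h) auto

lemma fv_ren_term:
  "fv_cterm (ren_cterm \<pi> M) = \<pi> ` fv_cterm M"
  "fv_aterm (ren_aterm \<pi> R) = \<pi> ` fv_aterm R"
  by (induction M and R rule: cterm.induct aterm.induct) (auto simp: fv_ren_head)

lemma fv_ren_atype: "fv_atype (ren_atype \<pi> P) = \<pi> ` fv_atype P"
  by (induction P) (auto simp: fv_ren_term)

lemma fv_ren_ty: "fv_ty (ren_ty \<pi> A) = \<pi> ` fv_ty A"
  by (induction A) (auto simp: fv_ren_atype)

lemma ren_head_closed: "fv_head h = {} \<Longrightarrow> ren_head \<pi> h = h"
  by (cases h) auto

lemma ren_term_closed:
  "fv_cterm M = {} \<Longrightarrow> ren_cterm \<pi> M = M"
  "fv_aterm R = {} \<Longrightarrow> ren_aterm \<pi> R = R"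
  by (induction M and R rule: cterm.induct aterm.induct) (auto simp: ren_head_closed)

lemma ren_atype_closed: "fv_atype P = {} \<Longrightarrow> ren_atype \<pi> P = P"
  by (induction P) (auto simp: ren_term_closed)

lemma ren_ty_closed: "fv_ty A = {} \<Longrightarrow> ren_ty \<pi> A = A"
  by (induction A) (auto simp: ren_atype_closed)

lemma erase_ren_ty [simp]: "erase (ren_ty \<pi> A) = erase A"
  by (induction A) auto

lemma ren_hres_of: "ren_hres \<pi> (hres_of M \<alpha>) = hres_of (ren_cterm \<pi> M) \<alpha>"
  by (cases M) auto

lemma ren_subst_empty: "ren_subst \<pi> Map.empty = Map.empty"
  by (simp add: ren_subst_def)

lemma ren_subst_upd:
  assumes "bij \<pi>"
  shows "ren_subst \<pi> (\<theta>(x \<mapsto> (M, \<alpha>))) = (ren_subst \<pi> \<theta>)(\<pi> x \<mapsto> (ren_cterm \<pi> M, \<alpha>))"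
proof
  fix z
  have "inv \<pi> z = x \<longleftrightarrow> z = \<pi> x"
    using bij_inv_eq_iff[OF assms, of x z] by auto
  then show "ren_subst \<pi> (\<theta>(x \<mapsto> (M, \<alpha>))) z
      = ((ren_subst \<pi> \<theta>)(\<pi> x \<mapsto> (ren_cterm \<pi> M, \<alpha>))) z"
    by (simp only: ren_subst_def fun_upd_apply) simp
qed

lemma ren_subst_apply: "bij \<pi> \<Longrightarrow> ren_subst \<pi> \<theta> (\<pi> x) = map_option (map_prod (ren_cterm \<pi>) id) (\<theta> x)"
  by (simp add: ren_subst_def bij_is_inj)

text \<open>Carries the freshness side conditions of the binder rules over to the renamed
  substitution.\<close>

lemma fv_ren_subst:
  assumes "bij \<pi>"
  shows "fv_subst (ren_subst \<pi> \<theta>) = \<pi> ` fv_subst \<theta>"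
proof -
  have "dom (ren_subst \<pi> \<theta>) = \<pi> ` dom \<theta>"
    using assms by (force simp: ren_subst_def bij_is_inj bij_is_surj surj_f_inv_f image_iff dom_def)
  moreover have "ran (ren_subst \<pi> \<theta>) = map_prod (ren_cterm \<pi>) id ` ran \<theta>"
  proof
    show "ran (ren_subst \<pi> \<theta>) \<subseteq> map_prod (ren_cterm \<pi>) id ` ran \<theta>"
      by (force simp: ren_subst_def ran_def)
    show "map_prod (ren_cterm \<pi>) id ` ran \<theta> \<subseteq> ran (ren_subst \<pi> \<theta>)"
    proof
      fix v assume "v \<in> map_prod (ren_cterm \<pi>) id ` ran \<theta>"
      then obtain x w where "\<theta> x = Some w" "v = map_prod (ren_cterm \<pi>) id w"
        by (auto simp: ran_def)
      then have "ren_subst \<pi> \<theta> (\<pi> x) = Some v"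
        by (simp add: ren_subst_apply[OF assms])
      then show "v \<in> ran (ren_subst \<pi> \<theta>)" by (rule ranI)
    qed
  qed
  ultimately show ?thesis
    by (fastforce simp: fv_subst_def fv_ren_term image_Un image_UN)
qed

section \<open>Equivariance of hereditary substitution\<close>

text \<open>Each rule is mapped to itself, with a binder opened by \<open>\<pi> x\<close> where the
  original derivation used \<open>x\<close>. Injectivity keeps \<open>\<pi> x\<close> fresh, and
  bijectivity makes lookups at \<open>\<pi> x\<close> agree with those at \<open>x\<close>.\<close>

lemma hsub_ren_term:
  assumes "bij \<pi>"
  shows "hsub_cterm \<theta> M M' \<Longrightarrow> hsub_cterm (ren_subst \<pi> \<theta>) (ren_cterm \<pi> M) (ren_cterm \<pi> M')"
    and "hsub_aterm \<theta> R r \<Longrightarrow> hsub_aterm (ren_subst \<pi> \<theta>) (ren_aterm \<pi> R) (ren_hres \<pi> r)"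
proof (induction rule: hsub_cterm_hsub_aterm.inducts)
  case (hsub_Lam x M M' \<theta>)
  show ?case
    using hsub_Lam assms
    by (auto simp: ren_open_term fv_ren_term fv_ren_subst bij_is_inj inj_image_mem_iff
        intro!: hsub_cterm_hsub_aterm.hsub_Lam[where x = "\<pi> x"])
next
  case (hsub_Free_None \<theta> x)
  then show ?case
    by (simp add: hsub_cterm_hsub_aterm.hsub_Free_None ren_subst_apply assms)
next
  case (hsub_Free_Some \<theta> x M \<alpha>)
  then show ?case
    by (simp add: hsub_cterm_hsub_aterm.hsub_Free_Some ren_subst_apply ren_hres_of assms)
next
  case (hsub_Beta \<theta> R N \<alpha> \<beta> M M' x N')
  \<comment> \<open>The substitution that contracts the redex is an update of the empty map, so its
    renaming is again a singleton, now at \<open>\<pi> x\<close>.\<close>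
  then have "hsub_cterm [\<pi> x \<mapsto> (ren_cterm \<pi> M', \<alpha>)] (open_cterm 0 (\<pi> x) (ren_cterm \<pi> N))
      (ren_cterm \<pi> N')"
    using ren_subst_upd[OF assms, of Map.empty x M' \<alpha>]
    by (simp only: ren_open_term ren_subst_empty)
  moreover have "\<pi> x \<notin> fv_cterm (ren_cterm \<pi> N)"
    using hsub_Beta by (simp add: fv_ren_term bij_is_inj[OF assms] inj_image_mem_iff)
  ultimately show ?case
    using hsub_Beta by (auto simp: ren_hres_of intro: hsub_cterm_hsub_aterm.hsub_Beta)
qed (auto intro: hsub_cterm_hsub_aterm.intros)

lemma hsub_ren_atype:
  assumes "bij \<pi>"
  shows "hsub_atype \<theta> P P' \<Longrightarrow> hsub_atype (ren_subst \<pi> \<theta>) (ren_atype \<pi> P) (ren_atype \<pi> P')"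
  by (induction rule: hsub_atype.induct) (auto intro: hsub_atype.intros hsub_ren_term[OF assms])

lemma hsub_ren_ty:
  assumes "bij \<pi>"
  shows "hsub_ty \<theta> A A' \<Longrightarrow> hsub_ty (ren_subst \<pi> \<theta>) (ren_ty \<pi> A) (ren_ty \<pi> A')"
proof (induction rule: hsub_ty.induct)
  case (hsub_AtTy \<theta> P P')
  then show ?case by (auto intro: hsub_ty.intros hsub_ren_atype[OF assms])
next
  case (hsub_Pi \<theta> A A' x B B')
  then show ?case
    using assms
    by (auto simp: ren_open_ty fv_ren_ty fv_ren_subst bij_is_inj inj_image_mem_iff
        intro!: hsub_ty.hsub_Pi[where x = "\<pi> x"])
qed

section \<open>Permutation substitutions are renamings\<close>

text \<open>When \<open>x\<close> is fresh, every \<open>x\<close> in the opened term stems from the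
  index \<open>k\<close>, so the body can be recovered. The binder rules of substitution describe
  their result only after opening; this turns such a description into an equation between
  bodies.\<close>

lemma open_term_inject:
  "\<lbrakk>open_cterm k x M = open_cterm k x M'; x \<notin> fv_cterm M \<union> fv_cterm M'\<rbrakk> \<Longrightarrow> M = M'"
  "\<lbrakk>open_aterm k x R = open_aterm k x R'; x \<notin> fv_aterm R \<union> fv_aterm R'\<rbrakk> \<Longrightarrow> R = R'"
proof (induction M and R arbitrary: k M' and k R' rule: cterm.induct aterm.induct)
  case (At R)
  then show ?case by (cases M') auto
next
  case (Lam M)
  then show ?case by (cases M') auto
next
  case (Hd h)
  then show ?case by (cases R') (auto split: if_splits)
next
  case (Bound i)
  then show ?case by (cases R') (auto split: if_splits)
next
  case (App R M)
  then show ?case by (cases R') (auto split: if_splits)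
qed

lemma open_atype_inject:
  "\<lbrakk>open_atype k x P = open_atype k x P'; x \<notin> fv_atype P \<union> fv_atype P'\<rbrakk> \<Longrightarrow> P = P'"
proof (induction P arbitrary: P')
  case (TConst a)
  then show ?case by (cases P') auto
next
  case (TApp P M)
  then show ?case by (cases P') (auto dest: open_term_inject)
qed

lemma open_ty_inject:
  "\<lbrakk>open_ty k x A = open_ty k x A'; x \<notin> fv_ty A \<union> fv_ty A'\<rbrakk> \<Longrightarrow> A = A'"
proof (induction A arbitrary: k A')
  case (AtTy P)
  then show ?case by (cases A') (auto dest: open_atype_inject)
next
  case (Pi A B)
  then show ?case by (cases A') auto
qed

text \<open>The domain of the substitution is exactly the set of moved variables, so a name chosen
  for a binder is fixed by \<open>\<pi>\<close>.\<close>

lemma perm_subst_fresh: "x \<notin> fv_subst (perm_subst \<Theta> \<pi>) \<Longrightarrow> \<pi> x = x"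
  by (auto simp: fv_subst_def perm_subst_def dom_def split: if_splits)

lemma perm_fresh_image: "\<lbrakk>bij \<pi>; \<pi> x = x; x \<notin> S\<rbrakk> \<Longrightarrow> x \<notin> \<pi> ` S"
  by (metis bij_is_inj inj_image_mem_iff)

text \<open>A variable is either left alone or replaced by a variable, so every result for an atomic
  term is an \<open>AtRes\<close>. By the induction hypothesis this rules out
  \<open>hsub_At_Lam\<close> and \<open>hsub_Beta\<close>, whose premises need a
  \<open>LamRes\<close>; the remaining rules merely rename.\<close>

lemma hsub_perm_term:
  assumes "bij \<pi>"
  shows "hsub_cterm \<theta> M M' \<Longrightarrow> \<theta> = perm_subst \<Theta> \<pi> \<Longrightarrow> M' = ren_cterm \<pi> M"
    and "hsub_aterm \<theta> R r \<Longrightarrow> \<theta> = perm_subst \<Theta> \<pi> \<Longrightarrow> r = AtRes (ren_aterm \<pi> R)"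
proof (induction rule: hsub_cterm_hsub_aterm.inducts)
  case (hsub_Lam x M M' \<theta>)
  then have x: "\<pi> x = x" using perm_subst_fresh by blast
  \<comment> \<open>Renaming turns opening with \<open>x\<close> into opening with
    \<open>\<pi> x\<close>, which is \<open>x\<close> itself.\<close>
  then have "open_cterm 0 x M' = open_cterm 0 x (ren_cterm \<pi> M)"
    using hsub_Lam by (simp add: ren_open_term)
  moreover have "x \<notin> fv_cterm (ren_cterm \<pi> M)"
    using hsub_Lam x assms by (simp add: fv_ren_term perm_fresh_image)
  ultimately show ?case using hsub_Lam by (auto dest: open_term_inject)
qed (auto simp: perm_subst_def split: if_splits)

lemma hsub_perm_atype:
  assumes "bij \<pi>"
  shows "hsub_atype \<theta> P P' \<Longrightarrow> \<theta> = perm_subst \<Theta> \<pi> \<Longrightarrow> P' = ren_atype \<pi> P"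
  by (induction rule: hsub_atype.induct) (auto dest: hsub_perm_term(1)[OF assms])

lemma hsub_perm_ty:
  assumes "bij \<pi>"
  shows "hsub_ty \<theta> A A' \<Longrightarrow> \<theta> = perm_subst \<Theta> \<pi> \<Longrightarrow> A' = ren_ty \<pi> A"
proof (induction rule: hsub_ty.induct)
  case (hsub_AtTy \<theta> P P')
  then show ?case by (auto dest: hsub_perm_atype[OF assms])
next
  case (hsub_Pi \<theta> A A' x B B')
  then have x: "\<pi> x = x" using perm_subst_fresh by blast
  then have "open_ty 0 x B' = open_ty 0 x (ren_ty \<pi> B)"
    using hsub_Pi by (simp add: ren_open_ty)
  moreover have "x \<notin> fv_ty (ren_ty \<pi> B)"
    using hsub_Pi x assms by (simp add: fv_ren_ty perm_fresh_image)
  ultimately show ?case using hsub_Pi by (auto dest: open_ty_inject)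
qed

section \<open>Free variables of the result of a substitution\<close>

text \<open>The variables that a substitution can introduce; unlike \<open>fv_subst\<close> it
  leaves out the domain.\<close>

definition fv_range :: "subst \<Rightarrow> var set" where
  "fv_range \<theta> = (\<Union>(M, \<alpha>) \<in> ran \<theta>. fv_cterm M)"

primrec fv_hres :: "hres \<Rightarrow> var set" where
  "fv_hres (AtRes R) = fv_aterm R"
| "fv_hres (LamRes M \<alpha>) = fv_cterm M"

lemma fv_hres_of [simp]: "fv_hres (hres_of M \<alpha>) = fv_cterm M"
  by (cases M) auto

text \<open>In the binder cases below, the upper bound is applied to the body before substitution
  and the lower bound to the body of the result.\<close>

lemma fv_open_term:
  "fv_cterm M \<subseteq> fv_cterm (open_cterm k x M) \<and> fv_cterm (open_cterm k x M) \<subseteq> insert x (fv_cterm M)"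
  "fv_aterm R \<subseteq> fv_aterm (open_aterm k x R) \<and> fv_aterm (open_aterm k x R) \<subseteq> insert x (fv_aterm R)"
  by (induction M and R arbitrary: k and k rule: cterm.induct aterm.induct)
     (simp_all, blast+)

lemma fv_open_atype:
  "fv_atype P \<subseteq> fv_atype (open_atype k x P) \<and> fv_atype (open_atype k x P) \<subseteq> insert x (fv_atype P)"
  using fv_open_term by (induction P) (simp_all, blast)

lemma fv_open_ty:
  "fv_ty A \<subseteq> fv_ty (open_ty k x A) \<and> fv_ty (open_ty k x A) \<subseteq> insert x (fv_ty A)"
  using fv_open_atype by (induction A arbitrary: k) (simp_all, blast)

lemma fv_hsub_term:
  "hsub_cterm \<theta> M M' \<Longrightarrow> fv_cterm M' \<subseteq> (fv_cterm M - dom \<theta>) \<union> fv_range \<theta>"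
  "hsub_aterm \<theta> R r \<Longrightarrow> fv_hres r \<subseteq> (fv_aterm R - dom \<theta>) \<union> fv_range \<theta>"
proof (induction rule: hsub_cterm_hsub_aterm.inducts)
  case (hsub_Lam x M M' \<theta>)
  then show ?case
    using fv_open_term(1)[of M 0 x] fv_open_term(1)[of M' 0 x] by auto
next
  case (hsub_Free_Some \<theta> x M \<alpha>)
  then show ?case by (force simp: fv_range_def ran_def)
next
  case (hsub_Beta \<theta> R N \<alpha> \<beta> M M' x N')
  \<comment> \<open>The domain of the singleton removes the \<open>x\<close> that opening added.
    What remains comes from \<open>N\<close> and \<open>M'\<close>, both bounded by the other
    induction hypotheses.\<close>
  have "fv_cterm N' \<subseteq> (fv_cterm (open_cterm 0 x N) - dom [x \<mapsto> (M', \<alpha>)])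
      \<union> fv_range [x \<mapsto> (M', \<alpha>)]"
    by (rule hsub_Beta.IH)
  then have "fv_cterm N' \<subseteq> fv_cterm N \<union> fv_cterm M'"
    using fv_open_term(1)[of N 0 x] by (auto simp: fv_range_def)
  then show ?case using hsub_Beta by auto
qed auto

lemma fv_hsub_atype: "hsub_atype \<theta> P P' \<Longrightarrow> fv_atype P' \<subseteq> (fv_atype P - dom \<theta>) \<union> fv_range \<theta>"
  by (induction rule: hsub_atype.induct) (auto dest: fv_hsub_term)

lemma fv_hsub_ty: "hsub_ty \<theta> A A' \<Longrightarrow> fv_ty A' \<subseteq> (fv_ty A - dom \<theta>) \<union> fv_range \<theta>"
proof (induction rule: hsub_ty.induct)
  case (hsub_AtTy \<theta> P P')
  then show ?case by (auto dest: fv_hsub_atype)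
next
  case (hsub_Pi \<theta> A A' x B B')
  then show ?case
    using fv_open_ty[of B 0 x] fv_open_ty[of B' 0 x] by auto
qed

lemma fv_arity_term:
  "arity_cterm \<Theta> M \<alpha> \<Longrightarrow> fv_cterm M \<subseteq> {x. Free x \<in> dom \<Theta>}"
  "arity_aterm \<Theta> R \<alpha> \<Longrightarrow> fv_aterm R \<subseteq> {x. Free x \<in> dom \<Theta>}"
proof (induction rule: arity_cterm_arity_aterm.inducts)
  case (arity_Lam x M \<Theta> \<alpha> \<beta>)
  have "fv_cterm (open_cterm 0 x M) \<subseteq> {y. Free y \<in> dom (\<Theta>(Free x \<mapsto> \<alpha>))}"
    by (rule arity_Lam.IH)
  then show ?case
    using fv_open_term(1)[of M 0 x] arity_Lam.hyps(1) by auto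
next
  case (arity_Hd \<Theta> h \<alpha>)
  then show ?case by (cases h) auto
qed auto

text \<open>The context declares only constants and nominal constants. Hence the terms instantiating
  the parameters of a schema are closed, and the same terms serve for its variant.\<close>

lemma arity_term_closed:
  "arity_cterm (nom_arities ++ sig_arities \<Sigma>) t \<alpha> \<Longrightarrow> fv_cterm t = {}"
  by (drule fv_arity_term) (auto simp: nom_arities_def sig_arities_def)

section \<open>Instances of block schemas\<close>

text \<open>Erasure ignores variable names, so the same nominal constant still has the arity
  required by the renamed declaration.\<close>

lemma decls_inst_ren:
  assumes "bij \<pi>"
  shows "decls_inst \<Delta> G \<theta> \<Longrightarrow>
    decls_inst (map (map_prod \<pi> (ren_ty \<pi>)) \<Delta>) (map (map_prod id (ren_ty \<pi>)) G) (ren_subst \<pi> \<theta>)"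
proof (induction rule: decls_inst.induct)
  case decls_inst_Nil
  show ?case by (simp add: ren_subst_empty decls_inst.decls_inst_Nil)
next
  case (decls_inst_snoc \<Delta> G \<theta> n A A' y)
  then show ?case
    unfolding ren_subst_upd[OF assms]
    using decls_inst.decls_inst_snoc[OF decls_inst_snoc.IH, of n "ren_ty \<pi> A" "ren_ty \<pi> A'" "\<pi> y"]
    by (simp add: assms hsub_ren_ty fun_upd_def)
qed

text \<open>A declared type mentions only \<open>V\<close> and earlier declared variables. The
  latter form the domain of the substitution built so far and are replaced by nominal constants, so
  only variables of \<open>V\<close> survive.\<close>

lemma decls_inst_fv:
  assumes "decls_inst \<Delta> G \<theta>"
    and "\<forall>i < length \<Delta>. fv_ty (snd (\<Delta> ! i)) \<subseteq> V \<union> fst ` set (take i \<Delta>)"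
  shows "dom \<theta> = fst ` set \<Delta> \<and> fv_range \<theta> = {} \<and> (\<forall>(n, A) \<in> set G. fv_ty A \<subseteq> V)"
  using assms
proof (induction rule: decls_inst.induct)
  case decls_inst_Nil
  then show ?case by (simp add: fv_range_def)
next
  case (decls_inst_snoc \<Delta> G \<theta> n A A' y)
  have "fv_ty (snd (\<Delta> ! i)) \<subseteq> V \<union> fst ` set (take i \<Delta>)" if "i < length \<Delta>" for i
    using decls_inst_snoc.prems[rule_format, of i] that by (simp add: nth_append)
  then have IH: "dom \<theta> = fst ` set \<Delta>" "fv_range \<theta> = {}" "\<forall>(n, A) \<in> set G. fv_ty A \<subseteq> V"
    using decls_inst_snoc.IH by auto
  have "fv_ty A \<subseteq> V \<union> fst ` set \<Delta>"
    using decls_inst_snoc.prems[rule_format, of "length \<Delta>"] by simp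
  then have "fv_ty A' \<subseteq> V"
    using fv_hsub_ty[OF \<open>hsub_ty \<theta> A A'\<close>] IH by auto
  with IH(3) have "\<forall>(n, A) \<in> set (G @ [(n, A')]). fv_ty A \<subseteq> V" by auto
  moreover have "dom (\<theta>(y \<mapsto> (At (Hd (Nom n)), erase A))) = fst ` set (\<Delta> @ [(y, A)])"
    using IH(1) by simp
  moreover have "fv_range (\<theta>(y \<mapsto> (At (Hd (Nom n)), erase A))) = {}"
    using IH(2) unfolding fv_range_def ran_def by (fastforce split: if_splits)
  ultimately show ?case by (intro conjI)
qed

lemma hsub_ctx_ren:
  "\<lbrakk>bij \<pi>; hsub_ctx \<theta> G G'\<rbrakk> \<Longrightarrow>
    hsub_ctx (ren_subst \<pi> \<theta>) (map (map_prod id (ren_ty \<pi>)) G) (map (map_prod id (ren_ty \<pi>)) G')"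
  by (auto simp: hsub_ctx_def list_all2_map1 list_all2_map2 hsub_ren_ty elim!: list_all2_mono)

lemma hsub_ctx_fv:
  assumes "hsub_ctx \<theta> G G'" "\<forall>(n, A) \<in> set G. fv_ty A \<subseteq> dom \<theta>" "fv_range \<theta> = {}"
    "(n, A') \<in> set G'"
  shows "fv_ty A' = {}"
proof -
  obtain A where "(n, A) \<in> set G" "hsub_ty \<theta> A A'"
    using assms(1,4) unfolding hsub_ctx_def
    by (fastforce simp: list_all2_conv_all_nth in_set_conv_nth)
  then show ?thesis using fv_hsub_ty assms(2,3) by fastforce
qed

abbreviation param_subst :: "(var \<times> arity) list \<Rightarrow> cterm list \<Rightarrow> subst" where
  "param_subst X ts \<equiv> map_of (map2 (\<lambda>(x, \<alpha>) t. (x, (t, \<alpha>))) X ts)"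

text \<open>Closed terms are unaffected by renaming, so only the keys change.\<close>

lemma param_subst_ren:
  assumes "bij \<pi>" "length X = length ts" "\<forall>t \<in> set ts. fv_cterm t = {}"
  shows "ren_subst \<pi> (param_subst X ts) = param_subst (map (\<lambda>(x, \<alpha>). (\<pi> x, \<alpha>)) X) ts"
  using assms(2,3)
  by (induction X ts rule: list_induct2)
     (auto simp: ren_subst_empty ren_subst_upd assms(1) ren_term_closed)

lemma dom_param_subst:
  assumes "length X = length ts"
  shows "dom (param_subst X ts) = fst ` set X"
proof -
  have "map fst (map2 (\<lambda>(x, \<alpha>) t. (x, (t, \<alpha>))) X ts) = map fst X"
    using assms by (induction X ts rule: list_induct2) auto
  then show ?thesis by (simp only: dom_map_of_conv_image_fst flip: list.set_map)
qed

lemma fv_range_param_subst: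
  assumes "\<forall>t \<in> set ts. fv_cterm t = {}"
  shows "fv_range (param_subst X ts) = {}"
proof -
  have "fv_cterm M = {}" if "param_subst X ts x = Some (M, \<alpha>)" for x M \<alpha>
    using map_of_SomeD[OF that] assms by (auto dest: set_zip_rightD)
  then show ?thesis by (auto simp: fv_range_def ran_def)
qed

theorem theorem4p7:
  fixes \<Sigma> :: sig and \<B> \<B>' :: schema and G :: ctx_expr and \<pi> :: "var \<Rightarrow> var"
  assumes "wf_sig \<Sigma>"
    and "block_schema \<B>"
    and "block_inst \<Sigma> \<B> G"
    and "var_perm \<pi>"
    and "variant \<Sigma> \<pi> \<B> \<B>'"
  shows "block_inst \<Sigma> \<B>' G"
proof -
  have bij: "bij \<pi>" using assms(4) by (simp add: var_perm_def)
  from assms(3) obtain X \<Delta> G' \<theta> ts where \<B>: "\<B> = Schema X \<Delta>"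
    and inst: "decls_inst \<Delta> G' \<theta>"
    and ts: "list_all2 (\<lambda>(x, \<alpha>) t. arity_cterm (nom_arities ++ sig_arities \<Sigma>) t \<alpha>) X ts"
    and G: "hsub_ctx (param_subst X ts) G' G"
    by (auto elim: block_inst.cases)
  from assms(5) obtain \<Delta>' where \<B>': "\<B>' = Schema (map (\<lambda>(x, \<alpha>). (\<pi> x, \<alpha>)) X) \<Delta>'"
    and \<Delta>': "list_all2 (\<lambda>(y, A) (y', A'). y' = \<pi> y \<and>
       hsub_ty (perm_subst (schema_arities \<Sigma> \<B>) \<pi>) A A') \<Delta> \<Delta>'"
    unfolding \<B> by (auto elim: variant.cases)
  \<comment> \<open>The variant supplies derivations of the substituted types;
    \<open>hsub_perm_ty\<close> identifies their results as renamings.\<close>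
  have "list_all2 (\<lambda>b b'. map_prod \<pi> (ren_ty \<pi>) b = b') \<Delta> \<Delta>'"
    by (rule list_all2_mono[OF \<Delta>']) (auto dest: hsub_perm_ty[OF bij])
  then have \<Delta>'_eq: "\<Delta>' = map (map_prod \<pi> (ren_ty \<pi>)) \<Delta>"
    by (simp add: list_all2_conv_all_nth list_eq_iff_nth_eq)
  have len: "length X = length ts" using ts by (rule list_all2_lengthD)
  have closed: "\<forall>t \<in> set ts. fv_cterm t = {}"
    using ts by (fastforce simp: list_all2_conv_all_nth in_set_conv_nth dest: arity_term_closed)
  \<comment> \<open>The scoping condition of \<open>block_schema\<close> is used here, with the
    parameters as \<open>V\<close>.\<close>
  have "\<forall>(n, A) \<in> set G'. fv_ty A \<subseteq> fst ` set X"
    using decls_inst_fv[OF inst, of "fst ` set X"] assms(2) by (simp add: \<B>)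
  then have "fv_ty A = {}" if "(n, A) \<in> set G" for n A
    using hsub_ctx_fv[OF G _ fv_range_param_subst[OF closed] that]
    by (simp add: dom_param_subst[OF len])
  \<comment> \<open>All types in \<open>G\<close> are closed, so the renamed derivation ends in
    \<open>G\<close> itself.\<close>
  then have "map (map_prod id (ren_ty \<pi>)) G = G"
    by (auto intro!: map_idI simp: ren_ty_closed)
  with hsub_ctx_ren[OF bij G] have
    "hsub_ctx (param_subst (map (\<lambda>(x, \<alpha>). (\<pi> x, \<alpha>)) X) ts) (map (map_prod id (ren_ty \<pi>)) G') G"
    by (simp add: param_subst_ren[OF bij len closed])
  moreover have "list_all2 (\<lambda>(x, \<alpha>) t. arity_cterm (nom_arities ++ sig_arities \<Sigma>) t \<alpha>)
      (map (\<lambda>(x, \<alpha>). (\<pi> x, \<alpha>)) X) ts"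
    using ts by (simp add: list_all2_map1 case_prod_unfold)
  \<comment> \<open>The instance of the variant uses the renamed \<open>G'\<close>, the substitution
    \<open>ren_subst \<pi> \<theta>\<close> and the original terms \<open>ts\<close>.\<close>
  ultimately show ?thesis
    unfolding \<B>' \<Delta>'_eq using decls_inst_ren[OF bij inst] by (blast intro: block_inst.intros)
qed

end
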